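(* Let $A\subset\mathbb{N}$, $\alpha>0$ and $0<\gamma<1$. If $A$ is an IP-set (respectively a C-set, a D-set, a quasi-central set), then $g_{\alpha,\gamma}(A)$ is an IP-set (respectively a C-set, a D-set, a quasi-central set).
   Context: $\mathbb{N}$ is the set of positive integers. For $\alpha>0$, $0<\gamma<1$ and $A\subset\mathbb{N}$, $g_{\alpha,\gamma}(n)=\lfloor n\alpha+\gamma\rfloor$, and $g_{\alpha,\gamma}(A)=\{\lfloor n\alpha+\gamma\rfloor : n\in A\}\cap\mathbb{N}$ (a possible value $0$ is ignored). A set $A\subset\mathbb{N}$ is: - an IP-set if there is a sequence $\{p_n\}_{n=1}^\infty$ in $\mathbb{N}$ such that $\sum_{n\in F}p_n\in A$ for every non-empty finite $F\subset\mathbb{N}$; - a J-set if for every finite collection $\{p^i_n\}_{n=1}^\infty$, $i=1,\dots,m$, of sequences in $\mathbb{N}$ there exist $r\in\mathbb{N}$ and a non-empty finite $F\subset\mathbb{N}$ with $r+\sum_{n\in F}p^i_n\in A$ for all $i=1,\dots,m$; - piecewise syndetic if there exists $\ell>0$ such that $\bigcup_{i=0}^{\ell}(A-i)$ contains arbitrarily long integer intervals, i.e. for every $m\in\mathbb{N}$ there is $n\in\mathbb{N}$ with $n,n+1,\dots,n+m\in\bigcup_{i=0}^{\ell}(A-i)$, where $A-i=\{a-i:a\in A\}\cap\mathbb{N}$; - of positive upper Banach density if $BD^*(A)=\limsup_{(n-m)\to\infty}\frac{|A\cap[m,n]|}{n-m+1}>0$. Let $\mathcal{F}_{\mathrm{J}}$,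 $\mathcal{F}_{\mathrm{ps}}$, $\mathcal{F}_{\mathrm{pubd}}$ be the collections of J-sets, piecewise syndetic sets, and sets of positive upper Banach density. $\beta\mathbb{N}$ denotes the Stone–Čech compactification of $\mathbb{N}$, regarded as the set of all ultrafilters on $\mathbb{N}$, with the operation $+$ extended from $\mathbb{N}$ so that $(\beta\mathbb{N},+)$ is a compact Hausdorff right topological semigroup; an idempotent is $p\in\beta\mathbb{N}$ with $p+p=p$. A set $A\subset\mathbb{N}$ is a quasi-central set (resp. D-set, C-set) if there is an idempotent $p\in\beta\mathbb{N}$ with $A\in p$ and $p\subset\mathcal{F}_{\mathrm{ps}}$ (resp. $p\subset\mathcal{F}_{\mathrm{pubd}}$, $p\subset\mathcal{F}_{\mathrm{J}}$). *)

theory Defs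
  imports Complex_Main "HOL-Library.FuncSet" "HOL-Library.Extended_Real" "HOL-Library.Liminf_Limsup"
begin

text \<open>The natural numbers of the source are the positive integers.\<close>

abbreviation posN :: "nat set" where
  "posN \<equiv> {0<..}"

definition gmap :: "real \<Rightarrow> real \<Rightarrow> nat \<Rightarrow> nat" where
  "gmap \<alpha> \<gamma> n = nat \<lfloor>real n * \<alpha> + \<gamma>\<rfloor>"

definition gset :: "real \<Rightarrow> real \<Rightarrow> nat set \<Rightarrow> nat set" where
  "gset \<alpha> \<gamma> A = gmap \<alpha> \<gamma> ` A \<inter> posN"


section \<open>Notions of largeness\<close>

text \<open>Sequences are indexed by the positive integers; values at index 0 are irrelevant.\<close>

definition IP_set :: "nat set \<Rightarrow> bool" where
  "IP_set A \<longleftrightarrow> A \<subseteq> posN \<and>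
     (\<exists>p::nat \<Rightarrow> nat. p \<in> posN \<rightarrow> posN \<and>
        (\<forall>F. finite F \<and> F \<noteq> {} \<and> F \<subseteq> posN \<longrightarrow> (\<Sum>n\<in>F. p n) \<in> A))"

definition J_set :: "nat set \<Rightarrow> bool" where
  "J_set A \<longleftrightarrow> A \<subseteq> posN \<and>
     (\<forall>(m::nat) (p::nat \<Rightarrow> nat \<Rightarrow> nat). (\<forall>i\<in>{1..m}. p i \<in> posN \<rightarrow> posN) \<longrightarrow>
        (\<exists>r\<in>posN. \<exists>F. finite F \<and> F \<noteq> {} \<and> F \<subseteq> posN \<and>
           (\<forall>i\<in>{1..m}. r + (\<Sum>n\<in>F. p i n) \<in> A)))"

text \<open>Truncated subtraction is harmless here: the elements \<open>a < i\<close> of \<open>A\<close>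
  are sent to 0, which is removed again.\<close>

definition shift_down :: "nat set \<Rightarrow> nat \<Rightarrow> nat set" where
  "shift_down A i = (\<lambda>a. a - i) ` A \<inter> posN"

definition piecewise_syndetic :: "nat set \<Rightarrow> bool" where
  "piecewise_syndetic A \<longleftrightarrow> A \<subseteq> posN \<and>
     (\<exists>l>0. \<forall>m\<in>posN. \<exists>n\<in>posN. {n..n+m} \<subseteq> (\<Union>i\<in>{0..l}. shift_down A i))"

text \<open>The filter describes pairs \<open>(m, n)\<close> of positive integers with \<open>n - m \<rightarrow> \<infinity>\<close>.\<close>

definition upper_Banach_density :: "nat set \<Rightarrow> ereal" where
  "upper_Banach_density A =
     Limsup (inf (filtercomap (\<lambda>(m, n). int n - int m) at_top) (principal (posN \<times> posN)))
       (\<lambda>(m, n). ereal (real (card (A \<inter> {m..n})) / (real n - real m + 1)))"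

definition pos_upper_Banach_density :: "nat set \<Rightarrow> bool" where
  "pos_upper_Banach_density A \<longleftrightarrow> A \<subseteq> posN \<and> upper_Banach_density A > 0"

definition F_J :: "nat set set" where
  "F_J = {A. J_set A}"

definition F_ps :: "nat set set" where
  "F_ps = {A. piecewise_syndetic A}"

definition F_pubd :: "nat set set" where
  "F_pubd = {A. pos_upper_Banach_density A}"


section \<open>Ultrafilters on the positive integers\<close>

definition betaN :: "nat set set set" where
  "betaN = {p. p \<subseteq> Pow posN \<and> posN \<in> p \<and> {} \<notin> p \<and>
     (\<forall>A\<in>p. \<forall>B\<in>p. A \<inter> B \<in> p) \<and>
     (\<forall>A\<in>p. \<forall>B. A \<subseteq> B \<and> B \<subseteq> posN \<longrightarrow> B \<in> p) \<and>
     (\<forall>A. A \<subseteq> posN \<longrightarrow> A \<in> p \<or> posN - A \<in> p)}"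

text \<open>The extension of addition for which \<open>p \<mapsto> p + q\<close> is continuous for every \<open>q\<close>
  (the basic open sets of the Stone--Cech compactification being
  \<open>{p. A \<in> p}\<close>) and \<open>q \<mapsto> m + q\<close> is continuous for every \<open>m\<close> in \<open>posN\<close>.
  The other usual convention is \<open>(p, q) \<mapsto> q + p\<close> and has the same idempotents.\<close>

definition beta_add :: "nat set set \<Rightarrow> nat set set \<Rightarrow> nat set set" where
  "beta_add p q = {A. A \<subseteq> posN \<and> {x\<in>posN. {y\<in>posN. x + y \<in> A} \<in> q} \<in> p}"

definition principal_uf :: "nat \<Rightarrow> nat set set" where
  "principal_uf n = {A. A \<subseteq> posN \<and> n \<in> A}"

lemma principal_uf_in_betaN: "n \<in> posN \<Longrightarrow> principal_uf n \<in> betaN"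
  by (auto simp: principal_uf_def betaN_def)

lemma beta_add_principal_uf:
  assumes "m \<in> posN" "n \<in> posN"
  shows "beta_add (principal_uf m) (principal_uf n) = principal_uf (m + n)"
  using assms by (auto simp: principal_uf_def beta_add_def)

lemma beta_add_in_betaN:
  assumes p: "p \<in> betaN" and q: "q \<in> betaN"
  shows "beta_add p q \<in> betaN"
proof -
  define S where "S A x = {y\<in>posN. x + y \<in> A}" for A :: "nat set" and x
  define T where "T A = {x\<in>posN. S A x \<in> q}" for A
  have mem: "A \<in> beta_add p q \<longleftrightarrow> A \<subseteq> posN \<and> T A \<in> p" for A
    by (simp add: beta_add_def T_def S_def)
  have top: "posN \<in> r" and bot: "{} \<notin> r" if "r \<in> betaN" for r
    using that unfolding betaN_def by blast+
  have int: "A \<inter> B \<in> r" if "r \<in> betaN" "A \<in> r" "B \<in> r" for r A B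
    using that unfolding betaN_def by blast
  have up: "B \<in> r" if "r \<in> betaN" "A \<in> r" "A \<subseteq> B" "B \<subseteq> posN" for r A B
    using that unfolding betaN_def by blast
  have ultra: "A \<in> r \<or> posN - A \<in> r" if "r \<in> betaN" "A \<subseteq> posN" for r A
    using that unfolding betaN_def by blast
  have Tsub: "T A \<subseteq> posN" for A unfolding T_def by blast
  have Ssub: "S A x \<subseteq> posN" for A x unfolding S_def by blast
  have S_top: "x \<in> posN \<Longrightarrow> S posN x = posN" and S_bot: "S {} x = {}"
    and S_int: "S (A \<inter> B) x = S A x \<inter> S B x"
    and S_compl: "x \<in> posN \<Longrightarrow> S (posN - A) x = posN - S A x"
    and S_mono: "A \<subseteq> B \<Longrightarrow> S A x \<subseteq> S B x" for A B x
    by (auto simp: S_def)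
  have T_top: "T posN = posN" using S_top top[OF q] unfolding T_def by fastforce
  have T_bot: "T {} = {}" using bot[OF q] by (simp add: T_def S_bot)
  have T_int: "T A \<inter> T B \<subseteq> T (A \<inter> B)" for A B
    using int[OF q] unfolding T_def S_int by blast
  have T_mono: "T A \<subseteq> T B" if "A \<subseteq> B" for A B
    using up[OF q _ S_mono[OF that] Ssub] unfolding T_def by blast
  have T_compl: "posN - T A \<subseteq> T (posN - A)" for A
  proof
    fix x assume "x \<in> posN - T A"
    then have "x \<in> posN" "S A x \<notin> q" unfolding T_def by blast+
    then show "x \<in> T (posN - A)"
      using ultra[OF q Ssub] S_compl unfolding T_def by fastforce
  qed
  show ?thesis unfolding betaN_def
  proof (intro CollectI conjI ballI allI impI)
    show "beta_add p q \<subseteq> Pow posN" using mem by blast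
    show "posN \<in> beta_add p q" unfolding mem T_top using top[OF p] by blast
    show "{} \<notin> beta_add p q" unfolding mem T_bot using bot[OF p] by blast
  next
    fix A B assume "A \<in> beta_add p q" "B \<in> beta_add p q"
    then show "A \<inter> B \<in> beta_add p q"
      unfolding mem using up[OF p int[OF p] T_int Tsub] by blast
  next
    fix A B assume "A \<in> beta_add p q" "A \<subseteq> B \<and> B \<subseteq> posN"
    then show "B \<in> beta_add p q"
      unfolding mem using up[OF p _ T_mono Tsub] by blast
  next
    fix A :: "nat set" assume "A \<subseteq> posN"
    then show "A \<in> beta_add p q \<or> posN - A \<in> beta_add p q"
      unfolding mem using ultra[OF p Tsub] up[OF p _ T_compl Tsub] by blast
  qed
qed

definition idempotent_uf :: "nat set set \<Rightarrow> bool" where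
  "idempotent_uf p \<longleftrightarrow> p \<in> betaN \<and> beta_add p p = p"

definition quasi_central_set :: "nat set \<Rightarrow> bool" where
  "quasi_central_set A \<longleftrightarrow> A \<subseteq> posN \<and> (\<exists>p. idempotent_uf p \<and> A \<in> p \<and> p \<subseteq> F_ps)"

definition D_set :: "nat set \<Rightarrow> bool" where
  "D_set A \<longleftrightarrow> A \<subseteq> posN \<and> (\<exists>p. idempotent_uf p \<and> A \<in> p \<and> p \<subseteq> F_pubd)"

definition C_set :: "nat set \<Rightarrow> bool" where
  "C_set A \<longleftrightarrow> A \<subseteq> posN \<and> (\<exists>p. idempotent_uf p \<and> A \<in> p \<and> p \<subseteq> F_J)"

end

theory Submission
  imports Defs
begin

text \<open>If \<open>n\<alpha>\<close> is at distance less than \<open>min \<gamma> (1 - \<gamma>)\<close> from an integer \<open>z\<close>, then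
  \<open>\<lfloor>n\<alpha> + \<gamma>\<rfloor> = z\<close>, so \<open>n \<mapsto> \<lfloor>n\<alpha> + \<gamma>\<rfloor>\<close> is additive on the \<open>n\<close> with distance less than half of this.
  An idempotent ultrafilter \<open>p\<close> contains the set of these \<open>n\<close>, because the \<open>p\<close>-limit of \<open>n\<alpha>\<close> modulo 1
  is an idempotent of the circle group, that is, 0. Hence the image of \<open>p\<close> is again an idempotent, and it
  remains to see that images of members of \<open>p\<close> are large. Piecewise syndeticity and positive
  upper Banach density are preserved because \<open>n \<mapsto> \<lfloor>n\<alpha> + \<gamma>\<rfloor>\<close> distorts distances in a bounded way. For IP-sets
  and J-sets, the pigeonhole principle on a torus replaces the given sequences by sums over blocks
  whose multiples by \<open>\<alpha>\<close> or \<open>1/\<alpha>\<close> have summable distances to integers.\<close>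

section \<open>The map\<close>

lemma gmap_bounds:
  assumes "0 < \<alpha>" "0 < \<gamma>"
  shows "real (gmap \<alpha> \<gamma> n) \<le> real n * \<alpha> + \<gamma>" "real n * \<alpha> + \<gamma> < real (gmap \<alpha> \<gamma> n) + 1"
proof -
  have "0 \<le> real n * \<alpha> + \<gamma>" using assms by simp
  then have "real (gmap \<alpha> \<gamma> n) = of_int \<lfloor>real n * \<alpha> + \<gamma>\<rfloor>"
    unfolding gmap_def by (simp add: le_floor_iff)
  then show "real (gmap \<alpha> \<gamma> n) \<le> real n * \<alpha> + \<gamma>" "real n * \<alpha> + \<gamma> < real (gmap \<alpha> \<gamma> n) + 1"
    by linarith+
qed

lemma gmap_mono: "0 < \<alpha> \<Longrightarrow> m \<le> n \<Longrightarrow> gmap \<alpha> \<gamma> m \<le> gmap \<alpha> \<gamma> n"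
  unfolding gmap_def by (intro nat_mono floor_mono) simp

text \<open>The rounding errors at \<open>n\<close> and \<open>n + d\<close> both lie in [0, 1), so
  they differ by less than 1. This is the bounded distortion behind the statements on syndeticity
  and density.\<close>

lemma gmap_diff:
  assumes "0 < \<alpha>" "0 < \<gamma>"
  shows "real (gmap \<alpha> \<gamma> (n + d)) < real (gmap \<alpha> \<gamma> n) + real d * \<alpha> + 1"
    "real (gmap \<alpha> \<gamma> n) + real d * \<alpha> < real (gmap \<alpha> \<gamma> (n + d)) + 1"
  using gmap_bounds[OF assms, of n] gmap_bounds[OF assms, of "n + d"]
  by (simp_all add: algebra_simps)

lemma gmap_pos:
  assumes "0 < \<alpha>" "0 < \<gamma>" "1 \<le> real n * \<alpha>"
  shows "0 < gmap \<alpha> \<gamma> n"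
  using gmap_bounds(2)[OF assms(1,2), of n] assms by (cases "gmap \<alpha> \<gamma> n = 0") auto

text \<open>The error carries \<open>x + \<gamma>\<close> neither below \<open>z\<close> nor up to
  \<open>z + 1\<close>. Since \<epsilon> is a separate variable, the bound can also be applied to a
  sum of two errors.\<close>

lemma floor_near_int:
  fixes x :: real
  assumes "\<bar>x - of_int z\<bar> < \<epsilon>" "\<epsilon> \<le> \<gamma>" "\<epsilon> \<le> 1 - \<gamma>"
  shows "\<lfloor>x + \<gamma>\<rfloor> = z"
  using assms by (intro floor_unique) linarith+

lemma gmap_near_int:
  assumes "\<bar>real n * \<alpha> - of_int z\<bar> < \<epsilon>" "\<epsilon> \<le> \<gamma>" "\<epsilon> \<le> 1 - \<gamma>"
  shows "gmap \<alpha> \<gamma> n = nat z"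
  using floor_near_int[OF assms] by (simp add: gmap_def)

lemma gmap_int:
  assumes "0 < \<alpha>" "0 < \<gamma>"
  shows "int (gmap \<alpha> \<gamma> n) = \<lfloor>real n * \<alpha> + \<gamma>\<rfloor>"
  using assms unfolding gmap_def by (simp add: le_floor_iff)


section \<open>Sums over blocks that are close to integers\<close>

text \<open>Pigeonhole on the torus with one coordinate for each \<open>i\<close> in
  \<open>I\<close>: among infinitely many vectors of partial sums, two lie in the same box of side
  \<open>1 / M\<close>, and the block between them has near-integer sums. The parameters
  \<open>N\<close> and \<open>L\<close> allow blocks to be chosen disjoint and long.\<close>

lemma block_near_ints:
  fixes x :: "'i \<Rightarrow> nat \<Rightarrow> real"
  assumes I: "finite I" and \<epsilon>: "0 < \<epsilon>"
  shows "\<exists>a b. N \<le> a \<and> a + L \<le> b \<and> (\<forall>i\<in>I. \<exists>z::int. \<bar>(\<Sum>n\<in>{a..<b}. x i n) - of_int z\<bar> < \<epsilon>)"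
proof -
  obtain M :: nat where M: "M \<noteq> 0" "1 / real M < \<epsilon>"
    using real_arch_inverse[of \<epsilon>] \<epsilon> by (auto simp: inverse_eq_divide)
  define s where "s i j = (\<Sum>n<j. x i n)" for i j
  \<comment> \<open>Cut points from \<open>N\<close> on at mutual distance more than
    \<open>L\<close>, so that every block between two of them is long enough.\<close>
  define t where "t j = N + Suc L * j" for j
  \<comment> \<open>The box of the torus that contains the vector of partial sums at the
    \<open>j\<close>-th cut point. Restriction to \<open>I\<close> leaves only finitely many
    values.\<close>
  define c where "c j = (\<lambda>i\<in>I. \<lfloor>frac (s i (t j)) * real M\<rfloor>)" for j
  have "c j \<in> I \<rightarrow>\<^sub>E {0..<int M}" for j
  proof -
    have "\<lfloor>frac y * real M\<rfloor> \<in> {0..<int M}" for y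
    proof -
      have "frac y * real M < 1 * real M"
        using M frac_lt_1[of y] by (intro mult_strict_right_mono) auto
      then show ?thesis by (simp add: floor_less_iff le_floor_iff)
    qed
    then show ?thesis unfolding c_def by (intro restrict_PiE_iff[THEN iffD2]) blast
  qed
  then have "range c \<subseteq> I \<rightarrow>\<^sub>E {0..<int M}" by blast
  then have "finite (range c)" using I by (meson finite_PiE finite_atLeastLessThan_int finite_subset)
  then have "\<not> inj c" using finite_imageD infinite_UNIV_nat by blast
  then obtain j k where jk: "j < k" "c j = c k"
    unfolding inj_def by (metis linorder_neqE_nat)
  have le: "t j + L \<le> t k"
  proof -
    have "Suc L * Suc j \<le> Suc L * k" using jk(1) by (intro mult_le_mono2) simp
    then show ?thesis unfolding t_def by simp
  qed
  have "\<exists>z::int. \<bar>(\<Sum>n\<in>{t j..<t k}. x i n) - of_int z\<bar> < \<epsilon>" if i: "i \<in> I" for i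
  proof -
    have eq: "(\<Sum>n\<in>{t j..<t k}. x i n) = s i (t k) - s i (t j)"
    proof -
      have "sum (x i) {0..<t j} + sum (x i) {t j..<t k} = sum (x i) {0..<t k}"
        using le by (intro sum.atLeastLessThan_concat) auto
      then show ?thesis unfolding s_def lessThan_atLeast0 by simp
    qed
    have "\<lfloor>frac (s i (t j)) * real M\<rfloor> = \<lfloor>frac (s i (t k)) * real M\<rfloor>"
      using fun_cong[OF jk(2), of i] i by (simp add: c_def)
    then have "\<bar>frac (s i (t k)) * real M - frac (s i (t j)) * real M\<bar> < 1" by linarith
    then have "\<bar>frac (s i (t k)) - frac (s i (t j))\<bar> * real M < 1"
      by (simp add: abs_mult flip: left_diff_distrib)
    then have "\<bar>frac (s i (t k)) - frac (s i (t j))\<bar> < 1 / real M"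
      using M by (simp add: field_simps)
    then have "\<bar>(\<Sum>n\<in>{t j..<t k}. x i n) - of_int (\<lfloor>s i (t k)\<rfloor> - \<lfloor>s i (t j)\<rfloor>)\<bar> < \<epsilon>"
      using M(2) unfolding eq frac_def by simp
    then show ?thesis by blast
  qed
  then show ?thesis using le unfolding t_def by (metis le_add1)
qed

lemma sum_half_powers_lt:
  assumes "finite F" "F \<subseteq> posN"
  shows "(\<Sum>k\<in>F. (1/2::real) ^ k) < 1"
proof -
  have F: "F \<subseteq> {1..Max F}"
    using assms Max_ge by (fastforce simp: Suc_le_eq)
  have "(\<Sum>k\<in>{1..N}. (1/2::real) ^ k) = 1 - (1/2) ^ N" for N
    by (induction N) auto
  then show ?thesis
    using sum_mono2[OF _ F, of "\<lambda>k. (1/2::real) ^ k"] by (simp add: order.strict_trans1)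
qed

text \<open>Infinitely many successive blocks \<open>H k\<close> are chosen, the \<open>k\<close>-th
  with error below \<eta> / 2^k for all \<open>i\<close> at once. With \<open>G F\<close> the union
  of the blocks indexed by \<open>F\<close>, the errors add up to less than \<delta> for every
  finite \<open>F\<close>, as all indices in \<open>F\<close> are at least 1.\<close>

lemma block_sums_near_ints:
  fixes p :: "'i \<Rightarrow> nat \<Rightarrow> nat" and \<beta> \<delta> :: real
  assumes I: "finite I" and p: "\<forall>i\<in>I. p i \<in> posN \<rightarrow> posN" and \<beta>: "0 < \<beta>" and \<delta>: "0 < \<delta>"
  obtains G :: "nat set \<Rightarrow> nat set" and z :: "'i \<Rightarrow> nat \<Rightarrow> nat"
  where "\<And>i k. i \<in> I \<Longrightarrow> 0 < z i k"
    and "\<And>F. finite F \<Longrightarrow> F \<noteq> {} \<Longrightarrow> F \<subseteq> posN \<Longrightarrow> finite (G F) \<and> G F \<noteq> {} \<and> G F \<subseteq> posN \<and>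
      (\<forall>i\<in>I. \<bar>real (\<Sum>n\<in>G F. p i n) * \<beta> - real (\<Sum>k\<in>F. z i k)\<bar> < \<delta>)"
proof -
  define \<eta> where "\<eta> = min \<delta> 1"
  have \<eta>: "0 < \<eta>" "\<eta> \<le> \<delta>" "\<eta> \<le> 1" using \<delta> by (auto simp: \<eta>_def)
  \<comment> \<open>A block of at least \<open>L\<close> positive terms has a multiple by \<beta>
    above 2. As \<eta> is at most 1, the integer close to it is positive.\<close>
  obtain L :: nat where L: "2 < real L * \<beta>" using reals_Archimedean3[OF \<beta>] by blast
  define good where "good k ab \<longleftrightarrow> 0 < fst ab \<and> fst ab + L \<le> snd ab \<and>
    (\<forall>i\<in>I. \<exists>z::int. \<bar>(\<Sum>n\<in>{fst ab..<snd ab}. real (p i n) * \<beta>) - of_int z\<bar> < \<eta> * (1/2) ^ k)"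
    for k :: nat and ab :: "nat \<times> nat"
  have ex: "\<exists>ab. good k ab \<and> N \<le> fst ab" for k N
  proof -
    obtain a b where "Suc N \<le> a" "a + L \<le> b"
      "\<forall>i\<in>I. \<exists>z::int. \<bar>(\<Sum>n\<in>{a..<b}. real (p i n) * \<beta>) - of_int z\<bar> < \<eta> * (1/2) ^ k"
      \<comment> \<open>Starting from \<open>Suc N\<close> keeps index 0 out of the blocks, where
        nothing is known about the sequences.\<close>
      using block_near_ints[OF I, of "\<eta> * (1/2) ^ k" "Suc N" L "\<lambda>i n. real (p i n) * \<beta>"] \<eta> by auto
    then show ?thesis by (intro exI[of _ "(a, b)"]) (auto simp: good_def)
  qed
  obtain h where h: "\<And>k. good k (h k)" "\<And>k. snd (h k) \<le> fst (h (Suc k))"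
    using dependent_nat_choice[of good "\<lambda>k ab cd. snd ab \<le> fst cd"] ex by metis
  define H where "H k = {fst (h k)..<snd (h k)}" for k
  have L0: "L \<noteq> 0" using L by (metis mult_zero_left not_numeral_less_zero of_nat_0)
  have H: "finite (H k)" "H k \<noteq> {}" "H k \<subseteq> posN" "card (H k) \<ge> L" for k
    using h(1)[of k] L0 by (auto simp: good_def H_def)
  have mono: "snd (h j) \<le> fst (h k)" if "j < k" for j k
    using that
  proof (induction k)
    case (Suc k)
    have "fst (h k) \<le> snd (h k)" using h(1)[of k] by (simp add: good_def)
    then show ?case using Suc h(2)[of k] by (cases "j = k") auto
  qed simp
  have disj: "H j \<inter> H k = {}" if "j \<noteq> k" for j k
    using that mono[of j k] mono[of k j] by (fastforce simp: H_def linorder_neq_iff)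
  have "\<exists>z::nat. 0 < z \<and> \<bar>real (\<Sum>n\<in>H k. p i n) * \<beta> - real z\<bar> < \<eta> * (1/2) ^ k"
    if i: "i \<in> I" for i k
  proof -
    obtain z :: int where z: "\<bar>real (\<Sum>n\<in>H k. p i n) * \<beta> - of_int z\<bar> < \<eta> * (1/2) ^ k"
      using h(1)[of k] i by (auto simp: good_def H_def sum_distrib_right)
    have "card (H k) \<le> (\<Sum>n\<in>H k. p i n)"
      using sum_mono[of "H k" "\<lambda>_. 1" "p i"] p i H(3)[of k] by (fastforce simp: Suc_le_eq)
    then have "real L \<le> real (\<Sum>n\<in>H k. p i n)" using H(4)[of k] by linarith
    then have "real L * \<beta> \<le> real (\<Sum>n\<in>H k. p i n) * \<beta>" using \<beta> by (intro mult_right_mono) auto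
    moreover have "\<eta> * (1/2) ^ k \<le> 1 * 1"
      using \<eta> by (intro mult_mono) (auto simp: power_le_one)
    ultimately have "0 < z" using z L by linarith
    then show ?thesis using z by (intro exI[of _ "nat z"]) auto
  qed
  then obtain z where z: "\<And>i k. i \<in> I \<Longrightarrow> (0::nat) < z i k"
    "\<And>i k. i \<in> I \<Longrightarrow> \<bar>real (\<Sum>n\<in>H k. p i n) * \<beta> - real (z i k)\<bar> < \<eta> * (1/2) ^ k"
    by metis
  show thesis
  proof (rule that[of z "\<lambda>F. \<Union>k\<in>F. H k"])
    fix F :: "nat set" assume F: "finite F" "F \<noteq> {}" "F \<subseteq> posN"
    have "\<bar>real (\<Sum>n\<in>(\<Union>k\<in>F. H k). p i n) * \<beta> - real (\<Sum>k\<in>F. z i k)\<bar> < \<delta>" if i: "i \<in> I" for i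
    proof -
      have "(\<Sum>n\<in>(\<Union>k\<in>F. H k). p i n) = (\<Sum>k\<in>F. \<Sum>n\<in>H k. p i n)"
        using F H disj by (intro sum.UNION_disjoint) auto
      then have "\<bar>real (\<Sum>n\<in>(\<Union>k\<in>F. H k). p i n) * \<beta> - real (\<Sum>k\<in>F. z i k)\<bar>
        = \<bar>\<Sum>k\<in>F. real (\<Sum>n\<in>H k. p i n) * \<beta> - real (z i k)\<bar>"
        by (simp add: sum_distrib_right sum_subtractf)
      also have "\<dots> \<le> (\<Sum>k\<in>F. \<eta> * (1/2) ^ k)"
        by (rule order.trans[OF sum_abs sum_mono]) (use z(2)[OF i] in \<open>simp add: less_imp_le\<close>)
      also have "\<dots> = \<eta> * (\<Sum>k\<in>F. (1/2) ^ k)" by (simp add: sum_distrib_left)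
      also have "\<dots> < \<eta> * 1" using \<eta> sum_half_powers_lt[OF F(1,3)] by (intro mult_strict_left_mono) auto
      finally show ?thesis using \<eta> by simp
    qed
    then show "finite (\<Union>k\<in>F. H k) \<and> (\<Union>k\<in>F. H k) \<noteq> {} \<and> (\<Union>k\<in>F. H k) \<subseteq> posN \<and>
      (\<forall>i\<in>I. \<bar>real (\<Sum>n\<in>(\<Union>k\<in>F. H k). p i n) * \<beta> - real (\<Sum>k\<in>F. z i k)\<bar> < \<delta>)"
      using F H(1-3) by (intro conjI ballI finite_UN_I UN_least) auto
  qed (use z in auto)
qed


section \<open>Images of large sets\<close>

text \<open>The image is generated by the integers \<open>z\<close> near the multiples by \<alpha>
  of the block sums: a sum of \<open>p\<close> over a union of blocks lies in \<open>A\<close>, and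
  rounding sends it exactly to the corresponding sum of \<open>z\<close>.\<close>

lemma IP_set_gset:
  assumes "0 < \<alpha>" "0 < \<gamma>" "\<gamma> < 1" "IP_set A"
  shows "IP_set (gset \<alpha> \<gamma> A)"
proof -
  obtain p where p: "p \<in> posN \<rightarrow> posN"
    and A: "\<And>F. finite F \<Longrightarrow> F \<noteq> {} \<Longrightarrow> F \<subseteq> posN \<Longrightarrow> (\<Sum>n\<in>F. p n) \<in> A"
    using assms(4) unfolding IP_set_def by metis
  define \<epsilon> where "\<epsilon> = min \<gamma> (1 - \<gamma>)"
  have \<epsilon>: "0 < \<epsilon>" "\<epsilon> \<le> \<gamma>" "\<epsilon> \<le> 1 - \<gamma>" using assms by (auto simp: \<epsilon>_def)
  \<comment> \<open>The single sequence \<open>p\<close> is treated as a family indexed by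
    \<open>unit\<close>.\<close>
  obtain G :: "nat set \<Rightarrow> nat set" and z :: "unit \<Rightarrow> nat \<Rightarrow> nat"
    where z: "\<And>i k. i \<in> UNIV \<Longrightarrow> 0 < z i k"
    and G: "\<And>F. finite F \<Longrightarrow> F \<noteq> {} \<Longrightarrow> F \<subseteq> posN \<Longrightarrow> finite (G F) \<and> G F \<noteq> {} \<and> G F \<subseteq> posN \<and>
      (\<forall>i\<in>UNIV. \<bar>real (\<Sum>n\<in>G F. p n) * \<alpha> - real (\<Sum>k\<in>F. z i k)\<bar> < \<epsilon>)"
    using block_sums_near_ints[OF _ _ assms(1) \<epsilon>(1), of "UNIV :: unit set" "\<lambda>_. p"] p
    by (metis finite)
  have "(\<Sum>k\<in>F. z () k) \<in> gset \<alpha> \<gamma> A" if F: "finite F" "F \<noteq> {}" "F \<subseteq> posN" for F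
  proof -
    have "\<bar>real (\<Sum>n\<in>G F. p n) * \<alpha> - of_int (int (\<Sum>k\<in>F. z () k))\<bar> < \<epsilon>"
      using G[OF F] by simp
    from gmap_near_int[OF this \<epsilon>(2,3)]
    have "(\<Sum>k\<in>F. z () k) = gmap \<alpha> \<gamma> (\<Sum>n\<in>G F. p n)" by (simp only: nat_int)
    moreover have "0 < (\<Sum>k\<in>F. z () k)" using F z by (intro sum_pos) auto
    ultimately show ?thesis using A[of "G F"] G[OF F] by (auto simp: gset_def)
  qed
  then show ?thesis unfolding IP_set_def using z by (intro conjI exI[of _ "z ()"]) (auto simp: gset_def)
qed

text \<open>The given sequences live on the image side, so blocks are formed for
  \<open>1 / \<alpha>\<close>: each block sum \<open>P\<close> is close to \<alpha> times a sum of
  integers \<open>q\<close>. The J-property for the \<open>q\<close> gives points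
  \<open>x = s + \<Sum> q\<close> of \<open>A\<close> with \<open>x * \<alpha>\<close> near an
  integer. Then \<open>s * \<alpha>\<close> is near an integer too, rounding is additive here, and
  \<open>gmap \<alpha> \<gamma> s\<close> serves as the common translate.\<close>

lemma J_set_gset:
  assumes "0 < \<alpha>" "0 < \<gamma>" and \<epsilon>: "0 < \<epsilon>" "2 * \<epsilon> \<le> \<gamma>" "2 * \<epsilon> \<le> 1 - \<gamma>"
    and J: "J_set {n\<in>A. \<exists>z::int. \<bar>real n * \<alpha> - of_int z\<bar> < \<epsilon>}"
  shows "J_set (gset \<alpha> \<gamma> A)"
  unfolding J_set_def
proof (intro conjI allI impI)
  show "gset \<alpha> \<gamma> A \<subseteq> posN" by (simp add: gset_def)
next
  fix m :: nat and p :: "nat \<Rightarrow> nat \<Rightarrow> nat"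
  assume p: "\<forall>i\<in>{1..m}. p i \<in> posN \<rightarrow> posN"
  obtain G :: "nat set \<Rightarrow> nat set" and q :: "nat \<Rightarrow> nat \<Rightarrow> nat"
    where q: "\<And>i k. i \<in> {1..m} \<Longrightarrow> 0 < q i k"
    and G: "\<And>F. finite F \<Longrightarrow> F \<noteq> {} \<Longrightarrow> F \<subseteq> posN \<Longrightarrow> finite (G F) \<and> G F \<noteq> {} \<and> G F \<subseteq> posN \<and>
      (\<forall>i\<in>{1..m}. \<bar>real (\<Sum>n\<in>G F. p i n) * (1 / \<alpha>) - real (\<Sum>k\<in>F. q i k)\<bar> < \<epsilon> / \<alpha>)"
    using block_sums_near_ints[OF finite_atLeastAtMost p, of "1 / \<alpha>" "\<epsilon> / \<alpha>"]
      divide_pos_pos[OF zero_less_one assms(1)] divide_pos_pos[OF \<epsilon>(1) assms(1)] by metis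
  obtain c :: nat where c: "1 < real c * \<alpha>" using reals_Archimedean3[OF assms(1)] by blast
  \<comment> \<open>Adding \<open>c\<close> to every term of the sequences forces the common translate to be large,
    so that its image is positive.\<close>
  obtain r F where F: "finite F" "F \<noteq> {}" "F \<subseteq> posN"
    and rF: "\<forall>i\<in>{1..m}. r + (\<Sum>k\<in>F. q i k + c) \<in> {n\<in>A. \<exists>z::int. \<bar>real n * \<alpha> - of_int z\<bar> < \<epsilon>}"
  proof -
    have *: "\<forall>i\<in>{1..m}. (\<lambda>k. q i k + c) \<in> posN \<rightarrow> posN" using q by auto
    show ?thesis
      using J[unfolded J_set_def, THEN conjunct2, rule_format, of m "\<lambda>i k. q i k + c"] * that
      by blast
  qed
  define s where "s = r + card F * c"
  have "1 \<le> card F" using F by (simp add: Suc_le_eq card_gt_0_iff)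
  then have "c \<le> s" unfolding s_def by (metis le_add2 mult_le_mono1 mult_1 order.trans)
  then have "real c * \<alpha> \<le> real s * \<alpha>" using assms(1) by simp
  then have pos: "0 < gmap \<alpha> \<gamma> s" using c by (intro gmap_pos assms(1,2)) linarith
  have "gmap \<alpha> \<gamma> s + (\<Sum>n\<in>G F. p i n) \<in> gset \<alpha> \<gamma> A" if i: "i \<in> {1..m}" for i
  proof -
    define P where "P = (\<Sum>n\<in>G F. p i n)"
    define x where "x = s + (\<Sum>k\<in>F. q i k)"
    have "x = r + (\<Sum>k\<in>F. q i k + c)" by (simp add: x_def s_def sum.distrib)
    then have "x \<in> {n\<in>A. \<exists>z::int. \<bar>real n * \<alpha> - of_int z\<bar> < \<epsilon>}" using bspec[OF rF i] by (simp only:)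
    then obtain z :: int where x: "x \<in> A" and z: "\<bar>real x * \<alpha> - of_int z\<bar> < \<epsilon>" by blast
    have "\<bar>real P * (1 / \<alpha>) - real (\<Sum>k\<in>F. q i k)\<bar> < \<epsilon> / \<alpha>" using G[OF F] i unfolding P_def by blast
    then have "\<bar>real P * (1 / \<alpha>) - real (\<Sum>k\<in>F. q i k)\<bar> * \<alpha> < \<epsilon>"
      using assms(1) by (simp add: pos_less_divide_eq)
    moreover have "\<bar>real P * (1 / \<alpha>) - real (\<Sum>k\<in>F. q i k)\<bar> * \<alpha> = \<bar>real P - real (\<Sum>k\<in>F. q i k) * \<alpha>\<bar>"
    proof -
      have "\<bar>real P * (1 / \<alpha>) - real (\<Sum>k\<in>F. q i k)\<bar> * \<alpha>
        = \<bar>(real P * (1 / \<alpha>) - real (\<Sum>k\<in>F. q i k)) * \<alpha>\<bar>"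
        using assms(1) by (simp only: abs_mult abs_of_pos)
      then show ?thesis using assms(1) by (simp add: left_diff_distrib)
    qed
    ultimately have "\<bar>real P - real (\<Sum>k\<in>F. q i k) * \<alpha>\<bar> < \<epsilon>" by simp
    \<comment> \<open>Two errors add up: the distance of \<open>x * \<alpha>\<close> to
      \<open>z\<close>, and that of \<open>P\<close> to \<alpha> times the sum of the
      \<open>q\<close>. Hence the bounds on \<open>2 * \<epsilon>\<close>.\<close>
    then have "\<bar>real s * \<alpha> - of_int (z - int P)\<bar> < 2 * \<epsilon>"
      using z by (simp add: x_def distrib_right)
    from floor_near_int[OF this \<epsilon>(2,3)]
    have "int (gmap \<alpha> \<gamma> s) = z - int P" using gmap_int[OF assms(1,2)] by simp
    moreover have "int (gmap \<alpha> \<gamma> x) = z"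
      using floor_near_int[OF z, of \<gamma>] \<epsilon> gmap_int[OF assms(1,2)] by simp
    ultimately have "gmap \<alpha> \<gamma> s + P = gmap \<alpha> \<gamma> x" by simp
    then show ?thesis using x pos unfolding P_def gset_def by auto
  qed
  then show "\<exists>r\<in>posN. \<exists>F. finite F \<and> F \<noteq> {} \<and> F \<subseteq> posN \<and>
      (\<forall>i\<in>{1..m}. r + (\<Sum>n\<in>F. p i n) \<in> gset \<alpha> \<gamma> A)"
    using pos G[OF F] by blast
qed

section \<open>Piecewise syndetic sets\<close>

text \<open>For a target \<open>y\<close>, take the first \<open>x\<close> whose image reaches
  \<open>y\<close>. Some \<open>a\<close> in \<open>A\<close> lies at most \<open>l\<close> beyond
  \<open>x\<close>, so its image exceeds \<open>y\<close> by a bounded amount.\<close>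

lemma piecewise_syndetic_gset:
  assumes "0 < \<alpha>" "0 < \<gamma>" "piecewise_syndetic A"
  shows "piecewise_syndetic (gset \<alpha> \<gamma> A)"
proof -
  let ?g = "gmap \<alpha> \<gamma>"
  obtain l where l: "\<And>m. m \<in> posN \<Longrightarrow> \<exists>n\<in>posN. {n..n+m} \<subseteq> (\<Union>i\<in>{0..l}. shift_down A i)"
    using assms(3) unfolding piecewise_syndetic_def by blast
  \<comment> \<open>The overshoot of \<open>?g a\<close> over \<open>y\<close> is measured from the
    predecessor of \<open>x\<close>, whose image is below \<open>y\<close>. This makes
    \<open>l + 1\<close> steps, plus a rounding error below 1.\<close>
  obtain L :: nat where L: "(real l + 1) * \<alpha> + 1 < real L" using reals_Archimedean2 by blast
  have "\<exists>n\<in>posN. {n..n+m} \<subseteq> (\<Union>i\<in>{0..L}. shift_down (gset \<alpha> \<gamma> A) i)" for m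
  proof -
    \<comment> \<open>The surplus 2 pays for starting at \<open>?g n + 1\<close> and for the
      rounding error.\<close>
    obtain m0 :: nat where m0: "real m + 2 < real m0 * \<alpha>" using reals_Archimedean3[OF assms(1)] by blast
    then have "m0 \<in> posN" by (cases m0) auto
    then obtain n where n: "{n..n+m0} \<subseteq> (\<Union>i\<in>{0..l}. shift_down A i)" using l by blast
    \<comment> \<open>Starting one above \<open>?g n\<close> forces \<open>n < x\<close>, so
      \<open>x\<close> lies in the covered interval and has a predecessor.\<close>
    have "y \<in> (\<Union>i\<in>{0..L}. shift_down (gset \<alpha> \<gamma> A) i)" if y: "y \<in> {Suc (?g n)..Suc (?g n) + m}" for y
    proof -
      define x where "x = (LEAST x. y \<le> ?g x)"
      have "y \<le> ?g (n + m0)" using gmap_diff(2)[OF assms(1,2), of n m0] m0 y by auto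
      then have xle: "x \<le> n + m0" and yx: "y \<le> ?g x"
        unfolding x_def by (auto intro: Least_le LeastI)
      have "n < x" using yx y gmap_mono[OF assms(1), of x n \<gamma>] by (meson Suc_le_lessD atLeastAtMost_iff not_le order.trans not_less_eq_eq)
      then obtain x' where x': "x = Suc x'" by (cases x) auto
      have "?g x' < y" using x' not_less_Least[of x' "\<lambda>x. y \<le> ?g x"] unfolding x_def by auto
      have "x \<in> {n..n+m0}" using xle \<open>n < x\<close> by simp
      then obtain i where i: "i \<le> l" "x \<in> shift_down A i" using n by auto
      then obtain a where a: "a \<in> A" "a = x + i" unfolding shift_down_def using \<open>n < x\<close> by fastforce
      then have "a = x' + Suc i" using x' by simp
      then have "real (?g a) < real (?g x') + real (Suc i) * \<alpha> + 1"
        using gmap_diff(1)[OF assms(1,2), of x' "Suc i"] by simp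
      also have "\<dots> \<le> real y + (real l + 1) * \<alpha> + 1"
        using \<open>?g x' < y\<close> i(1) assms(1) by (intro add_mono mult_right_mono) auto
      finally have "?g a - y \<le> L" using L by linarith
      moreover have ya: "y \<le> ?g a" using yx gmap_mono[OF assms(1), of x a \<gamma>] a by simp
      moreover have "y \<in> shift_down (gset \<alpha> \<gamma> A) (?g a - y)"
      proof -
        have "?g a \<in> gset \<alpha> \<gamma> A" using a ya y unfolding gset_def by auto
        moreover have "y = ?g a - (?g a - y)" using ya by simp
        ultimately show ?thesis
          unfolding shift_down_def using y by (intro IntI rev_image_eqI[of "?g a"]) auto
      qed
      ultimately show ?thesis by auto
    qed
    then show ?thesis by (intro bexI[of _ "Suc (?g n)"]) auto
  qed
  moreover have "0 < L"
  proof -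
    have "0 \<le> (real l + 1) * \<alpha>" using assms(1) by simp
    then show ?thesis using L by linarith
  qed
  ultimately show ?thesis unfolding piecewise_syndetic_def gset_def by blast
qed

section \<open>Positive upper Banach density\<close>

text \<open>A positive limsup along the filter means that, for some positive \<open>e\<close>,
  density at least \<open>e\<close> occurs on arbitrarily long intervals.\<close>

lemma pos_upper_Banach_density_iff:
  "pos_upper_Banach_density A \<longleftrightarrow> A \<subseteq> posN \<and>
    (\<exists>e>0. \<forall>k. \<exists>m n. 0 < m \<and> m + k \<le> n \<and> e * (real n - real m + 1) \<le> real (card (A \<inter> {m..n})))"
    (is "_ \<longleftrightarrow> _ \<and> ?R")
proof -
  let ?F = "inf (filtercomap (\<lambda>(m, n). int n - int m) at_top) (principal (posN \<times> posN))"
  let ?f = "\<lambda>(m::nat, n::nat). ereal (real (card (A \<inter> {m..n})) / (real n - real m + 1))"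
  have ev: "eventually P ?F \<longleftrightarrow> (\<exists>k::nat. \<forall>m n. 0 < m \<and> m + k \<le> n \<longrightarrow> P (m, n))" for P :: "nat \<times> nat \<Rightarrow> bool"
  proof
    assume "eventually P ?F"
    then obtain k :: int where k: "\<And>m n. k \<le> int n - int m \<Longrightarrow> 0 < m \<Longrightarrow> 0 < n \<Longrightarrow> P (m, n)"
      unfolding eventually_inf_principal eventually_filtercomap_at_top_linorder by auto
    have "\<forall>m n. 0 < m \<and> m + nat k \<le> n \<longrightarrow> P (m, n)" by (auto intro!: k)
    then show "\<exists>k::nat. \<forall>m n. 0 < m \<and> m + k \<le> n \<longrightarrow> P (m, n)" by blast
  next
    assume "\<exists>k::nat. \<forall>m n. 0 < m \<and> m + k \<le> n \<longrightarrow> P (m, n)"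
    then obtain k :: nat where "\<And>m n. 0 < m \<Longrightarrow> m + k \<le> n \<Longrightarrow> P (m, n)" by blast
    then show "eventually P ?F"
      unfolding eventually_inf_principal eventually_filtercomap_at_top_linorder
      by (intro exI[of _ "int k"]) auto
  qed
  have "0 < Limsup ?F ?f \<longleftrightarrow> ?R"
  proof
    assume L: "0 < Limsup ?F ?f"
    then obtain e :: real where e: "0 < e" "ereal e < Limsup ?F ?f"
      using ereal_dense2[OF L] by auto
    have "\<exists>m n. 0 < m \<and> m + k \<le> n \<and> e * (real n - real m + 1) \<le> real (card (A \<inter> {m..n}))" for k
    proof (rule ccontr)
      assume *: "\<not> ?thesis"
      have "eventually (\<lambda>x. ?f x \<le> ereal e) ?F"
        unfolding ev
      proof (intro exI[of _ k] allI impI)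
        fix m n :: nat assume mn: "0 < m \<and> m + k \<le> n"
        then have "real (card (A \<inter> {m..n})) < e * (real n - real m + 1)" using * not_le by blast
        then show "(case (m, n) of (m, n) \<Rightarrow> ereal (real (card (A \<inter> {m..n})) / (real n - real m + 1))) \<le> ereal e"
          using mn by (simp add: pos_divide_le_eq)
      qed
      then show False using e Limsup_bounded by fastforce
    qed
    then show ?R using e by blast
  next
    assume ?R
    then obtain e where e: "0 < e"
      and *: "\<And>k. \<exists>m n. 0 < m \<and> m + k \<le> n \<and> e * (real n - real m + 1) \<le> real (card (A \<inter> {m..n}))" by blast
    show "0 < Limsup ?F ?f"
    proof (rule ccontr)
      assume "\<not> 0 < Limsup ?F ?f"
      then have "Limsup ?F ?f < ereal e" using e by (simp add: not_less order.strict_trans1)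
      then have "eventually (\<lambda>x. ?f x < ereal e) ?F" by (rule Limsup_lessD)
      then obtain k :: nat where k: "\<And>m n. 0 < m \<Longrightarrow> m + k \<le> n \<Longrightarrow>
          real (card (A \<inter> {m..n})) / (real n - real m + 1) < e"
        unfolding ev by auto
      obtain m n where "0 < m" "m + k \<le> n" "e * (real n - real m + 1) \<le> real (card (A \<inter> {m..n}))"
        using *[of k] by blast
      then show False using k[of m n] by (simp add: pos_divide_less_eq)
    qed
  qed
  then show ?thesis unfolding pos_upper_Banach_density_def upper_Banach_density_def by simp
qed

text \<open>Every fibre has at most \<open>K\<close> points: two distinct points in the same class
  modulo \<open>K\<close> are at least \<open>K\<close> apart, and over that distance the image
  increases because \<open>K * \<alpha>\<close> exceeds 1.\<close>

lemma card_gmap_image: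
  assumes "0 < \<alpha>" "0 < \<gamma>" "finite S" "1 < real K * \<alpha>"
  shows "card S \<le> card (gmap \<alpha> \<gamma> ` S) * K"
proof -
  have K: "0 < K" using assms(4) by (cases K) auto
  have le: "x \<ge> y" if eq: "gmap \<alpha> \<gamma> x = gmap \<alpha> \<gamma> y" "x mod K = y mod K" for x y
  proof (rule ccontr)
    assume "\<not> x \<ge> y"
    then have "K dvd y - x" "0 < y - x" using eq(2) by (auto simp: mod_eq_dvd_iff_nat dest: sym)
    then obtain d where "y = x + d" "K \<le> d" by (metis dvd_imp_le le_add_diff_inverse \<open>\<not> x \<ge> y\<close> nat_le_linear)
    then have "real K * \<alpha> \<le> real d * \<alpha>" "real (gmap \<alpha> \<gamma> x) + real d * \<alpha> < real (gmap \<alpha> \<gamma> y) + 1"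
      using assms gmap_diff(2)[OF assms(1,2), of x d] by auto
    then show False using eq(1) assms(4) by linarith
  qed
  then have "inj_on (\<lambda>x. (gmap \<alpha> \<gamma> x, x mod K)) S" by (intro inj_onI) (simp add: order_antisym)
  then have "card S \<le> card (gmap \<alpha> \<gamma> ` S \<times> {..<K})"
    by (rule card_inj_on_le) (use K assms(3) in auto)
  then show ?thesis by (simp add: card_cartesian_product)
qed

text \<open>Fibres are bounded and the length of an interval grows at most by a constant factor, so
  density on long intervals drops at most by a constant factor.\<close>

lemma pos_upper_Banach_density_gset:
  assumes "0 < \<alpha>" "0 < \<gamma>" "pos_upper_Banach_density A"
  shows "pos_upper_Banach_density (gset \<alpha> \<gamma> A)"
proof -
  let ?g = "gmap \<alpha> \<gamma>"
  obtain e where e: "0 < e"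
    and A: "\<And>k. \<exists>m n. 0 < m \<and> m + k \<le> n \<and> e * (real n - real m + 1) \<le> real (card (A \<inter> {m..n}))"
    using assms(3) unfolding pos_upper_Banach_density_iff by blast
  obtain K :: nat where K: "1 < real K * \<alpha>" using reals_Archimedean3[OF assms(1)] by blast
  then have K0: "0 < real K" by (cases K) auto
  \<comment> \<open>\<open>K\<close> comes from the fibres and \<open>\<alpha> + 1\<close> from the
    length of the image interval; the 2 absorbs one discarded point.\<close>
  define e' where "e' = e / (2 * real K * (\<alpha> + 1))"
  have "\<exists>M N. 0 < M \<and> M + k \<le> N \<and> e' * (real N - real M + 1) \<le> real (card (gset \<alpha> \<gamma> A \<inter> {M..N}))" for k
  proof -
    obtain k1 :: nat where k1: "real k + 2 < real k1 * \<alpha>" using reals_Archimedean3[OF assms(1)] by blast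
    \<comment> \<open>Long intervals make \<open>e * (real d + 1)\<close> at least
      \<open>2 * K\<close>, so the fibre over the discarded point \<open>?g m\<close> accounts for
      at most half of this bound.\<close>
    obtain k2 :: nat where k2: "2 * real K < real k2 * e" using reals_Archimedean3[OF e] by blast
    obtain m n where mn: "0 < m" "m + (k1 + k2) \<le> n"
      and card: "e * (real n - real m + 1) \<le> real (card (A \<inter> {m..n}))"
      using A by blast
    define d where "d = n - m"
    have n: "n = m + d" and d: "k1 \<le> d" "k2 \<le> d" using mn by (auto simp: d_def)
    have k1d: "real k1 * \<alpha> \<le> real d * \<alpha>" and k2d: "real k2 * e \<le> real d * e"
      using d assms(1) e by auto
    \<comment> \<open>The image \<open>?g m\<close> may be 0. Dropping it leaves a positive left end
      and only positive values.\<close>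
    have "?g ` (A \<inter> {m..n}) \<subseteq> insert (?g m) (gset \<alpha> \<gamma> A \<inter> {Suc (?g m)..?g n})"
    proof
      fix y assume "y \<in> ?g ` (A \<inter> {m..n})"
      then obtain x where x: "x \<in> A" "m \<le> x" "x \<le> n" "y = ?g x" by auto
      then have "?g m \<le> y" "y \<le> ?g n" using gmap_mono[OF assms(1)] by auto
      then show "y \<in> insert (?g m) (gset \<alpha> \<gamma> A \<inter> {Suc (?g m)..?g n})"
        using x by (cases "y = ?g m") (auto simp: gset_def)
    qed
    then have "card (?g ` (A \<inter> {m..n})) \<le> card (insert (?g m) (gset \<alpha> \<gamma> A \<inter> {Suc (?g m)..?g n}))"
      by (intro card_mono) auto
    also have "\<dots> \<le> Suc (card (gset \<alpha> \<gamma> A \<inter> {Suc (?g m)..?g n}))" by (rule card_insert_le_m1) auto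
    finally have "card (A \<inter> {m..n}) \<le> Suc (card (gset \<alpha> \<gamma> A \<inter> {Suc (?g m)..?g n})) * K"
      using card_gmap_image[OF assms(1,2) _ K, of "A \<inter> {m..n}"]
      by (meson finite_Int finite_atLeastAtMost mult_le_mono1 order.trans)
    then have "real (card (A \<inter> {m..n})) \<le> real (Suc (card (gset \<alpha> \<gamma> A \<inter> {Suc (?g m)..?g n})) * K)"
      by (rule of_nat_mono)
    then have "e * (real d + 1) \<le> (real (card (gset \<alpha> \<gamma> A \<inter> {Suc (?g m)..?g n})) + 1) * real K"
      using card unfolding n by (simp add: algebra_simps)
    moreover have "2 * real K \<le> e * (real d + 1)"
    proof -
      have "e * (real d + 1) = real d * e + e" by (simp add: algebra_simps)
      then show ?thesis using k2 k2d e by linarith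
    qed
    ultimately have lower: "e * (real d + 1) \<le> 2 * (real (card (gset \<alpha> \<gamma> A \<inter> {Suc (?g m)..?g n})) * real K)"
      by (simp add: algebra_simps)
    have upper: "real (?g n) - real (?g m) \<le> (real d + 1) * (\<alpha> + 1)"
      using gmap_diff(1)[OF assms(1,2), of m d] assms(1) unfolding n by (simp add: algebra_simps)
    have "e' * (real (?g n) - real (Suc (?g m)) + 1) \<le> e' * ((real d + 1) * (\<alpha> + 1))"
      using upper e K0 assms(1) unfolding e'_def by (intro mult_left_mono) auto
    also have "\<dots> = e * (real d + 1) / (2 * real K)"
    proof -
      have "\<alpha> + 1 \<noteq> 0" using assms(1) by simp
      then have "e * (real d + 1) * (\<alpha> + 1) / (2 * real K * (\<alpha> + 1)) = e * (real d + 1) / (2 * real K)"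
        by (rule mult_divide_mult_cancel_right)
      then show ?thesis by (simp only: e'_def times_divide_eq_left mult.assoc)
    qed
    also have "\<dots> \<le> real (card (gset \<alpha> \<gamma> A \<inter> {Suc (?g m)..?g n}))"
      using lower K0 by (simp add: pos_divide_le_eq algebra_simps)
    finally have "e' * (real (?g n) - real (Suc (?g m)) + 1) \<le> real (card (gset \<alpha> \<gamma> A \<inter> {Suc (?g m)..?g n}))" .
    moreover have "Suc (?g m) + k \<le> ?g n"
      using gmap_diff(2)[OF assms(1,2), of m d] k1 k1d unfolding n by linarith
    ultimately show ?thesis by blast
  qed
  moreover have "0 < e'" using e K0 assms(1) by (simp add: e'_def)
  ultimately show ?thesis unfolding pos_upper_Banach_density_iff gset_def by blast
qed


section \<open>Idempotent ultrafilters\<close>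

lemma betaN_posN: "p \<in> betaN \<Longrightarrow> posN \<in> p"
  and betaN_empty: "p \<in> betaN \<Longrightarrow> {} \<notin> p"
  and betaN_subset: "p \<in> betaN \<Longrightarrow> A \<in> p \<Longrightarrow> A \<subseteq> posN"
  and betaN_Int: "p \<in> betaN \<Longrightarrow> A \<in> p \<Longrightarrow> B \<in> p \<Longrightarrow> A \<inter> B \<in> p"
  and betaN_mono: "p \<in> betaN \<Longrightarrow> A \<in> p \<Longrightarrow> A \<subseteq> B \<Longrightarrow> B \<subseteq> posN \<Longrightarrow> B \<in> p"
  and betaN_ultra: "p \<in> betaN \<Longrightarrow> A \<subseteq> posN \<Longrightarrow> A \<in> p \<or> posN - A \<in> p"
  unfolding betaN_def by blast+

text \<open>Ultrafilters are maximal, so one inclusion will be enough to prove idempotence.\<close>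

lemma betaN_eqI:
  assumes "p \<in> betaN" "q \<in> betaN" "p \<subseteq> q"
  shows "p = q"
proof (rule ccontr)
  assume "p \<noteq> q"
  then obtain A where A: "A \<in> q" "A \<notin> p" using assms by blast
  then have "posN - A \<in> q" using betaN_ultra betaN_subset assms by blast
  then have "A \<inter> (posN - A) \<in> q" using betaN_Int assms A by blast
  then show False using betaN_empty assms by simp
qed

lemma betaN_finite_partition:
  assumes p: "p \<in> betaN" and "finite S" "{n\<in>posN. f n \<in> S} \<in> p"
  shows "\<exists>c\<in>S. {n\<in>posN. f n = c} \<in> p"
  using assms(2,3)
proof (induction S)
  case empty
  then show ?case using betaN_empty[OF p] by simp
next
  case (insert c S)
  show ?case
  proof (cases "{n\<in>posN. f n = c} \<in> p")
    case False
    then have "posN - {n\<in>posN. f n = c} \<in> p" using betaN_ultra[OF p, of "{n\<in>posN. f n = c}"] by blast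
    then have "{n\<in>posN. f n \<in> insert c S} \<inter> (posN - {n\<in>posN. f n = c}) \<in> p"
      by (rule betaN_Int[OF p insert.prems])
    then have "{n\<in>posN. f n \<in> S} \<in> p" by (rule betaN_mono[OF p]) auto
    then show ?thesis using insert.IH by blast
  qed blast
qed

lemma idempotent_uf_iff:
  assumes "idempotent_uf p" "A \<subseteq> posN"
  shows "A \<in> p \<longleftrightarrow> {x\<in>posN. {y\<in>posN. x + y \<in> A} \<in> p} \<in> p"
proof -
  have "A \<in> p \<longleftrightarrow> A \<in> beta_add p p" using assms by (simp add: idempotent_uf_def)
  then show ?thesis using assms(2) by (simp add: beta_add_def)
qed

text \<open>Induction through \<open>p + p = p\<close>: adding a positive \<open>x\<close> to
  numbers above \<open>k\<close> gives numbers above \<open>k + 1\<close>.\<close>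

lemma idempotent_uf_tail:
  assumes p: "idempotent_uf p"
  shows "{k<..} \<in> p"
proof (induction k)
  case 0
  then show ?case using p betaN_posN by (simp add: idempotent_uf_def)
next
  case (Suc k)
  have pb: "p \<in> betaN" using p by (simp add: idempotent_uf_def)
  have "{y\<in>posN. x + y \<in> {Suc k<..}} \<in> p" if "x \<in> posN" for x
    by (rule betaN_mono[OF pb Suc]) (use that in auto)
  then have "{x\<in>posN. {y\<in>posN. x + y \<in> {Suc k<..}} \<in> p} = posN" by blast
  then show ?case using betaN_posN[OF pb] by (subst idempotent_uf_iff[OF p]) auto
qed

text \<open>One of finitely many arcs of length \<open>1 / M\<close> has its set of \<open>n\<close>
  in \<open>p\<close>. By idempotence some \<open>x\<close> in it has \<open>x + y\<close> in it for
  \<open>p\<close>-many \<open>y\<close>, and then \<open>y * \<alpha>\<close>, a difference of two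
  points of one arc, is close to an integer.\<close>

lemma idempotent_uf_near_int:
  assumes p: "idempotent_uf p" and \<epsilon>: "0 < \<epsilon>"
  shows "{n\<in>posN. \<exists>z::int. \<bar>real n * \<alpha> - of_int z\<bar> < \<epsilon>} \<in> p"
proof -
  have pb: "p \<in> betaN" using p by (simp add: idempotent_uf_def)
  obtain M :: nat where M: "M \<noteq> 0" "1 / real M < \<epsilon>"
    using real_arch_inverse[of \<epsilon>] \<epsilon> by (auto simp: inverse_eq_divide)
  define f where "f n = \<lfloor>frac (real n * \<alpha>) * real M\<rfloor>" for n :: nat
  have "f n \<in> {0..<int M}" for n
  proof -
    have "frac (real n * \<alpha>) * real M < 1 * real M"
      using M frac_lt_1 by (intro mult_strict_right_mono) auto
    then show ?thesis by (simp add: f_def floor_less_iff le_floor_iff)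
  qed
  then have "{n\<in>posN. f n \<in> {0..<int M}} = posN" by blast
  then obtain c where c: "{n\<in>posN. f n = c} \<in> p"
    using betaN_finite_partition[OF pb, of "{0..<int M}" f] betaN_posN[OF pb] by auto
  then have "{x\<in>posN. {y\<in>posN. x + y \<in> {n\<in>posN. f n = c}} \<in> p} \<in> p"
    using idempotent_uf_iff[OF p, of "{n\<in>posN. f n = c}"] by blast
  \<comment> \<open>The intersection ensures that \<open>x\<close> itself lies in the arc, not only
    the sums \<open>x + y\<close>.\<close>
  then have "{x\<in>posN. {y\<in>posN. x + y \<in> {n\<in>posN. f n = c}} \<in> p} \<inter> {n\<in>posN. f n = c} \<in> p"
    using c betaN_Int[OF pb] by blast
  then have "{x\<in>posN. {y\<in>posN. x + y \<in> {n\<in>posN. f n = c}} \<in> p} \<inter> {n\<in>posN. f n = c} \<noteq> {}"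
    using betaN_empty[OF pb] by metis
  then obtain x where x: "{y\<in>posN. x + y \<in> {n\<in>posN. f n = c}} \<in> p" "f x = c" by blast
  show ?thesis
  proof (rule betaN_mono[OF pb x(1)], rule subsetI)
    fix y assume "y \<in> {y\<in>posN. x + y \<in> {n\<in>posN. f n = c}}"
    then have y: "y \<in> posN" "f (x + y) = f x" using x(2) by auto
    let ?a = "real (x + y) * \<alpha>" and ?b = "real x * \<alpha>"
    have "\<bar>frac ?a * real M - frac ?b * real M\<bar> < 1" using y(2) unfolding f_def by linarith
    then have "\<bar>frac ?a - frac ?b\<bar> * real M < 1" by (simp add: abs_mult flip: left_diff_distrib)
    then have "\<bar>frac ?a - frac ?b\<bar> < 1 / real M" using M by (simp add: field_simps)
    then have "\<bar>real y * \<alpha> - of_int (\<lfloor>?a\<rfloor> - \<lfloor>?b\<rfloor>)\<bar> < \<epsilon>"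
      using M(2) unfolding frac_def by (simp add: distrib_right)
    then show "y \<in> {n\<in>posN. \<exists>z::int. \<bar>real n * \<alpha> - of_int z\<bar> < \<epsilon>}" using y(1) by blast
  qed auto
qed

section \<open>Image of an idempotent ultrafilter\<close>

text \<open>The set is the pushforward of \<open>p\<close>. It is an ultrafilter on the positive
  integers because \<open>gmap\<close> is positive on a tail, and idempotent because
  \<open>gmap\<close> is additive on a member \<open>E\<close> of \<open>p\<close>.\<close>

lemma idempotent_uf_gmap:
  assumes "0 < \<alpha>" "0 < \<gamma>" "\<gamma> < 1" and p: "idempotent_uf p"
  shows "idempotent_uf {C. C \<subseteq> posN \<and> {n\<in>posN. gmap \<alpha> \<gamma> n \<in> C} \<in> p}"
proof -
  let ?g = "gmap \<alpha> \<gamma>"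
  define q where "q = {C. C \<subseteq> posN \<and> {n\<in>posN. ?g n \<in> C} \<in> p}"
  have pb: "p \<in> betaN" using p by (simp add: idempotent_uf_def)
  obtain k :: nat where k: "1 < real k * \<alpha>" using reals_Archimedean3[OF assms(1)] by blast
  have gpos: "{n\<in>posN. 0 < ?g n} \<in> p"
  proof (rule betaN_mono[OF pb idempotent_uf_tail[OF p, of k]], rule subsetI)
    fix n assume n: "n \<in> {k<..}"
    then have "real k * \<alpha> \<le> real n * \<alpha>" using assms(1) by auto
    then show "n \<in> {n\<in>posN. 0 < ?g n}" using n k gmap_pos[OF assms(1,2), of n] by auto
  qed auto
  have qb: "q \<in> betaN" unfolding betaN_def
  proof (intro CollectI conjI ballI allI impI)
    show "q \<subseteq> Pow posN" by (auto simp: q_def)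
    show "posN \<in> q" using gpos by (simp add: q_def)
    show "{} \<notin> q" using betaN_empty[OF pb] by (simp add: q_def)
  next
    fix A B assume "A \<in> q" "B \<in> q"
    moreover have "{n\<in>posN. ?g n \<in> A \<inter> B} = {n\<in>posN. ?g n \<in> A} \<inter> {n\<in>posN. ?g n \<in> B}" by blast
    ultimately show "A \<inter> B \<in> q" using betaN_Int[OF pb] unfolding q_def by auto
  next
    fix A B assume AB: "A \<in> q" "A \<subseteq> B \<and> B \<subseteq> posN"
    have "{n\<in>posN. ?g n \<in> B} \<in> p"
      by (rule betaN_mono[OF pb, of "{n\<in>posN. ?g n \<in> A}"]) (use AB in \<open>auto simp: q_def\<close>)
    then show "B \<in> q" using AB by (simp add: q_def)
  next
    fix A :: "nat set" assume A: "A \<subseteq> posN"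
    have "{n\<in>posN. ?g n \<in> posN - A} \<in> p" if "{n\<in>posN. ?g n \<in> A} \<notin> p"
    proof -
      have "posN - {n\<in>posN. ?g n \<in> A} \<in> p"
        using that betaN_ultra[OF pb, of "{n\<in>posN. ?g n \<in> A}"] by blast
      then show ?thesis by (rule betaN_mono[OF pb betaN_Int[OF pb _ gpos]]) auto
    qed
    then show "A \<in> q \<or> posN - A \<in> q" using A by (auto simp: q_def)
  qed
  \<comment> \<open>Half the admissible distance, since the errors of two members of
    \<open>E\<close> are added.\<close>
  define \<epsilon> where "\<epsilon> = min \<gamma> (1 - \<gamma>) / 2"
  have \<epsilon>: "0 < \<epsilon>" "2 * \<epsilon> \<le> \<gamma>" "2 * \<epsilon> \<le> 1 - \<gamma>" using assms by (auto simp: \<epsilon>_def)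
  define E where "E = {n\<in>posN. \<exists>z::int. \<bar>real n * \<alpha> - of_int z\<bar> < \<epsilon>}"
  have E: "E \<in> p" unfolding E_def by (rule idempotent_uf_near_int[OF p \<epsilon>(1)])
  have add: "?g (m + n) = ?g m + ?g n" if mn: "m \<in> E" "n \<in> E" for m n
  proof -
    obtain y z :: int where y: "\<bar>real m * \<alpha> - of_int y\<bar> < \<epsilon>" and z: "\<bar>real n * \<alpha> - of_int z\<bar> < \<epsilon>"
      using mn unfolding E_def by blast
    then have "\<bar>real (m + n) * \<alpha> - of_int (y + z)\<bar> < 2 * \<epsilon>" by (simp add: distrib_right)
    from floor_near_int[OF this \<epsilon>(2,3)]
    have "int (?g (m + n)) = y + z" using gmap_int[OF assms(1,2)] by simp
    moreover have "int (?g m) = y" "int (?g n) = z"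
      using floor_near_int[OF y, of \<gamma>] floor_near_int[OF z, of \<gamma>] \<epsilon> gmap_int[OF assms(1,2)] by simp_all
    ultimately show ?thesis by linarith
  qed
  have "q \<subseteq> beta_add q q"
  proof
    fix C assume C: "C \<in> q"
    then have Cs: "C \<subseteq> posN" and "{n\<in>posN. ?g n \<in> C} \<in> p" by (auto simp: q_def)
    then have *: "{x\<in>posN. {y\<in>posN. x + y \<in> {n\<in>posN. ?g n \<in> C}} \<in> p} \<in> p" (is "?X \<in> p")
      by (subst idempotent_uf_iff[OF p, symmetric]) auto
    have "{x\<in>posN. ?g x \<in> {u\<in>posN. {v\<in>posN. u + v \<in> C} \<in> q}} \<in> p"
    \<comment> \<open>Both \<open>x\<close> and, below, \<open>y\<close> are restricted to
      \<open>E\<close>, so that \<open>?g (x + y)\<close> splits, and to positive images, so that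
      the values are in \<open>posN\<close>.\<close>
    proof (rule betaN_mono[OF pb betaN_Int[OF pb betaN_Int[OF pb * E] gpos]], rule subsetI)
      fix x assume x: "x \<in> ?X \<inter> E \<inter> {n\<in>posN. 0 < ?g n}"
      then have "{y\<in>posN. x + y \<in> {n\<in>posN. ?g n \<in> C}} \<in> p" (is "?Y \<in> p") by blast
      then have "{y\<in>posN. ?g y \<in> {v\<in>posN. ?g x + v \<in> C}} \<in> p"
        by (rule betaN_mono[OF pb betaN_Int[OF pb betaN_Int[OF pb _ E] gpos]])
          (use x add[of x] in auto)
      then have "{v\<in>posN. ?g x + v \<in> C} \<in> q" by (auto simp: q_def)
      then show "x \<in> {x\<in>posN. ?g x \<in> {u\<in>posN. {v\<in>posN. u + v \<in> C} \<in> q}}" using x by auto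
    qed auto
    then have "{u\<in>posN. {v\<in>posN. u + v \<in> C} \<in> q} \<in> q"
      unfolding q_def[THEN eqset_imp_iff, of "{u\<in>posN. {v\<in>posN. u + v \<in> C} \<in> q}"] by blast
    then show "C \<in> beta_add q q" using Cs by (simp add: beta_add_def)
  qed
  then have "beta_add q q = q" using betaN_eqI qb beta_add_in_betaN by metis
  then show ?thesis using qb unfolding idempotent_uf_def q_def by simp
qed

text \<open>The pushforward of \<open>p\<close> is the witness: each of its members contains the
  image of its own preimage, which is large. The family \<open>\<F>\<close> is left abstract to
  serve all three ultrafilter notions.\<close>

lemma idempotent_uf_gset:
  assumes "0 < \<alpha>" "0 < \<gamma>" "\<gamma> < 1" and p: "idempotent_uf p" "A \<in> p"
    and large: "\<And>B. B \<in> p \<Longrightarrow> gset \<alpha> \<gamma> B \<in> \<F>"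
    and up: "\<And>B C. B \<in> \<F> \<Longrightarrow> B \<subseteq> C \<Longrightarrow> C \<subseteq> posN \<Longrightarrow> C \<in> \<F>"
  shows "gset \<alpha> \<gamma> A \<subseteq> posN \<and> (\<exists>q. idempotent_uf q \<and> gset \<alpha> \<gamma> A \<in> q \<and> q \<subseteq> \<F>)"
proof -
  let ?g = "gmap \<alpha> \<gamma>"
  define q where "q = {C. C \<subseteq> posN \<and> {n\<in>posN. ?g n \<in> C} \<in> p}"
  have pb: "p \<in> betaN" using p by (simp add: idempotent_uf_def)
  have q: "idempotent_uf q" unfolding q_def by (rule idempotent_uf_gmap[OF assms(1-3) p(1)])
  then have "posN \<in> q" using betaN_posN by (simp add: idempotent_uf_def)
  then have gpos: "{n\<in>posN. ?g n \<in> posN} \<in> p" by (simp add: q_def)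
  have "{n\<in>posN. ?g n \<in> gset \<alpha> \<gamma> A} \<in> p"
    by (rule betaN_mono[OF pb betaN_Int[OF pb p(2) gpos]]) (auto simp: gset_def)
  then have "gset \<alpha> \<gamma> A \<in> q" by (simp add: q_def gset_def)
  moreover have "q \<subseteq> \<F>"
  proof
    fix C assume "C \<in> q"
    then have C: "C \<subseteq> posN" "{n\<in>posN. ?g n \<in> C} \<in> p" by (auto simp: q_def)
    then show "C \<in> \<F>" using up[OF large[OF C(2)]] by (auto simp: gset_def)
  qed
  ultimately show ?thesis using q by (auto simp: gset_def)
qed

section \<open>Upward closure of the families of large sets\<close>

lemma F_J_mono:
  assumes "B \<in> F_J" "B \<subseteq> C" "C \<subseteq> posN"
  shows "C \<in> F_J"
  unfolding F_J_def J_set_def mem_Collect_eq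
proof (intro conjI allI impI)
  fix m and p :: "nat \<Rightarrow> nat \<Rightarrow> nat"
  assume p: "\<forall>i\<in>{1..m}. p i \<in> posN \<rightarrow> posN"
  have "J_set B" using assms(1) by (simp add: F_J_def)
  from this[unfolded J_set_def, THEN conjunct2, rule_format, of m p] p
  obtain r F where "r \<in> posN" "finite F \<and> F \<noteq> {} \<and> F \<subseteq> posN"
    and B: "\<forall>i\<in>{1..m}. r + (\<Sum>n\<in>F. p i n) \<in> B"
    by blast
  moreover have "\<forall>i\<in>{1..m}. r + (\<Sum>n\<in>F. p i n) \<in> C" using B assms(2) by blast
  ultimately show "\<exists>r\<in>posN. \<exists>F. finite F \<and> F \<noteq> {} \<and> F \<subseteq> posN \<and>
      (\<forall>i\<in>{1..m}. r + (\<Sum>n\<in>F. p i n) \<in> C)" by blast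
qed (rule assms(3))

lemma F_ps_mono:
  assumes "B \<in> F_ps" "B \<subseteq> C" "C \<subseteq> posN"
  shows "C \<in> F_ps"
proof -
  obtain l where l: "0 < l" "\<forall>m\<in>posN. \<exists>n\<in>posN. {n..n+m} \<subseteq> (\<Union>i\<in>{0..l}. shift_down B i)"
    using assms(1) unfolding F_ps_def piecewise_syndetic_def by blast
  have "shift_down B i \<subseteq> shift_down C i" for i using assms(2) by (auto simp: shift_down_def)
  then have "(\<Union>i\<in>{0..l}. shift_down B i) \<subseteq> (\<Union>i\<in>{0..l}. shift_down C i)" by (rule UN_mono[OF order.refl])
  then have "\<forall>m\<in>posN. \<exists>n\<in>posN. {n..n+m} \<subseteq> (\<Union>i\<in>{0..l}. shift_down C i)"
    using l(2) order.trans by metis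
  then show ?thesis using l(1) assms(3) unfolding F_ps_def piecewise_syndetic_def mem_Collect_eq
    by (intro conjI exI[of _ l])
qed

lemma F_pubd_mono:
  assumes "B \<in> F_pubd" "B \<subseteq> C" "C \<subseteq> posN"
  shows "C \<in> F_pubd"
proof -
  obtain e where e: "e > 0"
    "\<forall>k. \<exists>m n. 0 < m \<and> m + k \<le> n \<and> e * (real n - real m + 1) \<le> real (card (B \<inter> {m..n}))"
    using assms(1) unfolding F_pubd_def pos_upper_Banach_density_iff mem_Collect_eq by blast
  have "real (card (B \<inter> {m..n})) \<le> real (card (C \<inter> {m..n}))" for m n
    using assms(2) by (intro of_nat_mono card_mono) auto
  then have "\<forall>k. \<exists>m n. 0 < m \<and> m + k \<le> n \<and> e * (real n - real m + 1) \<le> real (card (C \<inter> {m..n}))"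
    using e(2) order.trans by metis
  then show ?thesis using e(1) assms(3) unfolding F_pubd_def pos_upper_Banach_density_iff mem_Collect_eq
    by blast
qed

theorem corollary1p3:
  fixes A :: "nat set" and \<alpha> \<gamma> :: real
  assumes "A \<subseteq> posN" and "0 < \<alpha>" and "0 < \<gamma>" and "\<gamma> < 1"
  shows "(IP_set A \<longrightarrow> IP_set (gset \<alpha> \<gamma> A)) \<and>
         (C_set A \<longrightarrow> C_set (gset \<alpha> \<gamma> A)) \<and>
         (D_set A \<longrightarrow> D_set (gset \<alpha> \<gamma> A)) \<and>
         (quasi_central_set A \<longrightarrow> quasi_central_set (gset \<alpha> \<gamma> A))"
proof (intro conjI impI)
  assume "IP_set A"
  then show "IP_set (gset \<alpha> \<gamma> A)" by (rule IP_set_gset[OF assms(2-4)])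
next
  assume "C_set A"
  then obtain p where p: "idempotent_uf p" "A \<in> p" "p \<subseteq> F_J" unfolding C_set_def by blast
  then have pb: "p \<in> betaN" by (simp add: idempotent_uf_def)
  define \<epsilon> where "\<epsilon> = min \<gamma> (1 - \<gamma>) / 2"
  have \<epsilon>: "0 < \<epsilon>" "2 * \<epsilon> \<le> \<gamma>" "2 * \<epsilon> \<le> 1 - \<gamma>" using assms by (auto simp: \<epsilon>_def)
  have "gset \<alpha> \<gamma> B \<in> F_J" if B: "B \<in> p" for B
  proof -
    \<comment> \<open>The near-integer members of \<open>B\<close> still form a member of
      \<open>p\<close>, hence a J-set, as the transfer of J-sets requires.\<close>
    have "B \<inter> {n\<in>posN. \<exists>z::int. \<bar>real n * \<alpha> - of_int z\<bar> < \<epsilon>} \<in> p"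
      by (rule betaN_Int[OF pb B idempotent_uf_near_int[OF p(1) \<epsilon>(1)]])
    also have "B \<inter> {n\<in>posN. \<exists>z::int. \<bar>real n * \<alpha> - of_int z\<bar> < \<epsilon>}
      = {n\<in>B. \<exists>z::int. \<bar>real n * \<alpha> - of_int z\<bar> < \<epsilon>}"
      using betaN_subset[OF pb B] by blast
    finally have "J_set {n\<in>B. \<exists>z::int. \<bar>real n * \<alpha> - of_int z\<bar> < \<epsilon>}"
      using p(3) unfolding F_J_def by blast
    then show ?thesis using J_set_gset[OF assms(2,3) \<epsilon>] by (simp add: F_J_def)
  qed
  then show "C_set (gset \<alpha> \<gamma> A)"
    unfolding C_set_def by (rule idempotent_uf_gset[OF assms(2-4) p(1,2) _ F_J_mono])
next
  assume "D_set A"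
  then obtain p where p: "idempotent_uf p" "A \<in> p" "p \<subseteq> F_pubd" unfolding D_set_def by blast
  then have "gset \<alpha> \<gamma> B \<in> F_pubd" if "B \<in> p" for B
    using that pos_upper_Banach_density_gset[OF assms(2,3)] by (auto simp: F_pubd_def)
  then show "D_set (gset \<alpha> \<gamma> A)"
    unfolding D_set_def by (rule idempotent_uf_gset[OF assms(2-4) p(1,2) _ F_pubd_mono])
next
  assume "quasi_central_set A"
  then obtain p where p: "idempotent_uf p" "A \<in> p" "p \<subseteq> F_ps" unfolding quasi_central_set_def by blast
  then have "gset \<alpha> \<gamma> B \<in> F_ps" if "B \<in> p" for B
    using that piecewise_syndetic_gset[OF assms(2,3)] by (auto simp: F_ps_def)
  then show "quasi_central_set (gset \<alpha> \<gamma> A)"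
    unfolding quasi_central_set_def by (rule idempotent_uf_gset[OF assms(2-4) p(1,2) _ F_ps_mono])
qed

end
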